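(* Let $j^{(\operatorname{lrmin},\operatorname{asc})}_{n,i,k}(123)$ be the number of $123$-avoiding Jacobi permutations $\pi\in\mathfrak{S}_n$ with $\operatorname{lrmin}(\pi)=i$ and $\operatorname{asc}(\pi)=k$. For all $n,i,k$ with $n\geq i\geq k\geq0$ and $k\leq(n-i)/2$, \[ j^{(\operatorname{lrmin},\operatorname{asc})}_{n,i,k}(123)=\frac{1}{n+1}\binom{n+1}{k}\binom{n+1-k}{i-k}\binom{\frac{n-i}{2}-1}{k-1} \] if $n$ and $i$ have the same parity, and $j^{(\operatorname{lrmin},\operatorname{asc})}_{n,i,k}(123)=0$ otherwise.
   Context: A permutation of a finite set $S$ of positive integers is a word in which each element of $S$ appears exactly once; $\mathfrak{S}_n$ is the set of permutations of $\{1,\dots,n\}$ ($\mathfrak{S}_0$ contains only the empty permutation). For a permutation $\pi$ and a letter $x$ of $\pi$, $\rho_\pi(x)$ is the maximal consecutive subword of $\pi$ consisting of the letters immediately to the right of $x$ that are all larger than $x$. $\pi$ is Jacobi if $|\rho_\pi(x)|$ is even for all letters $x$. A permutation $\pi$ avoids a pattern $\sigma$ if no subword of $\pi$ has standardization (relative order) $\sigma$. A letter $\pi_j$ is a left-to-right minimum if $\pi_j<\pi_l$ for all $l<j$; $\operatorname{lrmin}(\pi)$ counts them. An ascent of $\pi\in\mathfrak{S}_n$ is an index $j\in[n-1]$ with $\pi_j<\pi_{j+1}$; $\operatorname{asc}(\pi)$ counts them. Binomial coefficients are read with the convention $\binom{-1}{-1}=1$ and $\binom{a}{b}=0$ whenever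 $b<0$ and $(a,b)\neq(-1,-1)$, or $b>a\geq0$. *)

theory Defs
  imports Complex_Main "HOL-Library.Sublist" "HOL-Combinatorics.Multiset_Permutations"
begin

text \<open>Permutations of a finite set \<open>S\<close> of positive integers are words without repetition,
  i.e. elements of \<^const>\<open>permutations_of_set\<close> \<open>S\<close>. Letters are indexed from 0.\<close>

definition rho :: "nat list \<Rightarrow> nat \<Rightarrow> nat list" where
  "rho \<pi> x = takeWhile (\<lambda>y. y > x) (tl (dropWhile (\<lambda>y. y \<noteq> x) \<pi>))"

definition Jacobi :: "nat list \<Rightarrow> bool" where
  "Jacobi \<pi> \<longleftrightarrow> (\<forall>x\<in>set \<pi>. even (length (rho \<pi> x)))"

definition standardization :: "nat list \<Rightarrow> nat list" where
  "standardization w = map (\<lambda>x. card {y \<in> set w. y \<le> x}) w"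

definition avoids :: "nat list \<Rightarrow> nat list \<Rightarrow> bool" where
  "avoids \<pi> \<sigma> \<longleftrightarrow> \<not> (\<exists>w. subseq w \<pi> \<and> standardization w = \<sigma>)"

definition lrmin :: "nat list \<Rightarrow> nat" where
  "lrmin \<pi> = card {j. j < length \<pi> \<and> (\<forall>l<j. \<pi> ! j < \<pi> ! l)}"

definition asc :: "nat list \<Rightarrow> nat" where
  "asc \<pi> = card {j. Suc j < length \<pi> \<and> \<pi> ! j < \<pi> ! Suc j}"

definition jacobi_count :: "nat list \<Rightarrow> nat \<Rightarrow> nat \<Rightarrow> nat \<Rightarrow> nat" where
  "jacobi_count \<sigma> n i k =
     card {\<pi> \<in> permutations_of_set {1..n}. Jacobi \<pi> \<and> avoids \<pi> \<sigma> \<and> lrmin \<pi> = i \<and> asc \<pi> = k}"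

text \<open>Binomial coefficients on integers with \<open>binom (-1) (-1) = 1\<close> and otherwise
  \<open>binom a b = 0\<close> for \<open>b < 0\<close>; for \<open>b > a \<ge> 0\<close> the value \<open>0\<close> is that of \<open>gchoose\<close>.\<close>

definition binom :: "int \<Rightarrow> int \<Rightarrow> real" where
  "binom a b = (if a = -1 \<and> b = -1 then 1 else if b < 0 then 0 else real_of_int a gchoose nat b)"

end

theory Submission
  imports Defs
begin

text \<open>
  In a 123-avoiding permutation the letters that are not left-to-right minima decrease, so
  \<open>\<rho>(x)\<close> is empty for such a letter \<open>x\<close>, while for a left-to-right minimum it is the block of
  letters before the next one. Hence the permutation is Jacobi iff all these blocks have even
  length, and its ascents correspond to the nonempty blocks. Reading the values \<open>n, ..., 1\<close> and
  recording \<open>0\<close> for a non-minimum and \<open>1 + |\<rho>(x)|\<close> for a left-to-right minimum \<open>x\<close> encodes the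
  permutation by a word of length \<open>n\<close> and sum \<open>n\<close> over \<open>{0, 1, 3, 5, ...}\<close> whose prefixes of
  length \<open>l\<close> have sum at most \<open>l\<close>. After prepending a \<open>0\<close> these are ballot words, which by the
  cycle lemma form the fraction \<open>1 / (n + 1)\<close> of all words of length \<open>n + 1\<close> and sum \<open>n\<close> with
  the same letters. The unrestricted words are counted by the two binomials placing the letters
  times the number of compositions of \<open>(n - i) / 2\<close> into \<open>k\<close> parts.
\<close>

section \<open>Appending a block after a new minimum\<close>

text \<open>In a word with distinct letters these are the letters that are not left-to-right minima.
  A letter added on the right completes a 123 pattern exactly when it exceeds one of them.\<close>

definition tops :: "nat list \<Rightarrow> nat set" where
  "tops \<pi> = {y. \<exists>x<y. subseq [x, y] \<pi>}"

lemma avoids_123_iff: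
  "avoids \<pi> [1, 2, 3] \<longleftrightarrow> \<not> (\<exists>x y z. x < y \<and> y < z \<and> subseq [x, y, z] \<pi>)"
proof -
  have "(\<exists>x y z. w = [x, y, z] \<and> x < y \<and> y < z) \<longleftrightarrow> standardization w = [1, 2, 3]" for w
  proof
    assume "\<exists>x y z. w = [x, y, z] \<and> x < y \<and> y < z"
    then obtain x y z where w: "w = [x, y, z]" "x < y" "y < z" by blast
    then have "{a \<in> set w. a \<le> x} = {x}" "{a \<in> set w. a \<le> y} = {x, y}"
      "{a \<in> set w. a \<le> z} = {x, y, z}" by auto
    then show "standardization w = [1, 2, 3]"
      using w by (simp add: standardization_def)
  next
    assume st: "standardization w = [1, 2, 3]"
    \<comment> \<open>The rank \<open>f\<close> is weakly monotone, so the increasing ranks 1, 2, 3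
      force increasing letters.\<close>
    define f where "f a = card {b \<in> set w. b \<le> a}" for a
    have mono: "f a \<le> f b" if "a \<le> b" for a b
      unfolding f_def using that by (intro card_mono) auto
    have "map f w = [1, 2, 3]"
      using st unfolding standardization_def f_def .
    then obtain x y z where w: "w = [x, y, z]" "f x = 1" "f y = 2" "f z = 3"
      by (auto simp: map_eq_Cons_conv)
    have "x < y" "y < z"
      using mono[of y x] mono[of z y] w by (auto simp flip: not_le)
    with w show "\<exists>x y z. w = [x, y, z] \<and> x < y \<and> y < z" by blast
  qed
  then show ?thesis
    unfolding avoids_def by metis
qed

lemma subseq_snoc_iff:
  "subseq (xs @ [x]) (ys @ [y]) \<longleftrightarrow> subseq (xs @ [x]) ys \<or> (x = y \<and> subseq xs ys)"
proof
  assume "subseq (xs @ [x]) (ys @ [y])"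
  then obtain a b where ab: "xs @ [x] = a @ b" "subseq a ys" "subseq b [y]"
    by (rule subseq_appendE)
  show "subseq (xs @ [x]) ys \<or> (x = y \<and> subseq xs ys)"
  proof (cases b rule: rev_cases)
    case Nil
    then show ?thesis using ab by simp
  next
    case (snoc b' z)
    then have "b' = []" using list_emb_length[OF ab(3)] by simp
    then show ?thesis using snoc ab by (auto simp: subseq_singleton_left)
  qed
next
  assume "subseq (xs @ [x]) ys \<or> (x = y \<and> subseq xs ys)"
  then show "subseq (xs @ [x]) (ys @ [y])"
    using subseq_rev_drop_many by auto
qed

lemma tops_snoc:
  "tops (\<pi> @ [z]) = tops \<pi> \<union> (if \<exists>x\<in>set \<pi>. x < z then {z} else {})"
proof -
  have "subseq [x, y] (\<pi> @ [z]) \<longleftrightarrow> subseq [x, y] \<pi> \<or> (y = z \<and> x \<in> set \<pi>)" for x y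
    using subseq_snoc_iff[of "[x]" y \<pi> z] by (simp add: subseq_singleton_left)
  then show ?thesis unfolding tops_def by auto
qed

lemma avoids_123_snoc:
  "avoids (\<pi> @ [z]) [1, 2, 3] \<longleftrightarrow> avoids \<pi> [1, 2, 3] \<and> (\<forall>y\<in>tops \<pi>. z \<le> y)"
proof -
  have "subseq [x, y, t] (\<pi> @ [z]) \<longleftrightarrow> subseq [x, y, t] \<pi> \<or> (t = z \<and> subseq [x, y] \<pi>)" for x y t
    using subseq_snoc_iff[of "[x, y]" t \<pi> z] by simp
  then show ?thesis
    unfolding avoids_123_iff tops_def by (auto simp flip: not_less)
qed

text \<open>\<open>u\<close> is smaller than everything before it, hence no top, and it is a smaller
  letter to the left of each letter of \<open>B\<close>.\<close>

lemma tops_append_Cons: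
  assumes "\<forall>x\<in>set \<sigma>. u < x" "\<forall>b\<in>set B. u < b"
  shows "tops (\<sigma> @ u # B) = tops \<sigma> \<union> set B"
  using assms(2)
proof (induction B rule: rev_induct)
  case Nil
  then show ?case using assms(1) tops_snoc[of \<sigma> u] by auto
next
  case (snoc b B)
  then show ?case using tops_snoc[of "\<sigma> @ u # B" b] by auto
qed

text \<open>When a letter of \<open>B\<close> is appended, the tops so far are those of
  \<open>\<sigma>\<close> and the block letters already written; it may exceed none of them.\<close>

lemma avoids_123_append_Cons:
  assumes "\<forall>x\<in>set \<sigma>. u < x" "\<forall>b\<in>set B. u < b"
  shows "avoids (\<sigma> @ u # B) [1, 2, 3] \<longleftrightarrow>
    avoids \<sigma> [1, 2, 3] \<and> sorted_wrt (\<ge>) B \<and> (\<forall>y\<in>tops \<sigma>. \<forall>b\<in>set B. b \<le> y)"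
  using assms(2)
proof (induction B rule: rev_induct)
  case Nil
  have "\<forall>y\<in>tops \<sigma>. u \<le> y"
    using assms(1) list_emb_set unfolding tops_def by (fastforce intro: less_imp_le)
  then show ?case using avoids_123_snoc[of \<sigma> u] by auto
next
  case (snoc b B)
  then show ?case
    using avoids_123_snoc[of "\<sigma> @ u # B" b] tops_append_Cons[of \<sigma> u B] assms(1)
    by (auto simp: sorted_wrt_append)
qed

section \<open>Runs to the right of a letter and the Jacobi property\<close>

lemma rho_append_right: "x \<notin> set xs \<Longrightarrow> rho (xs @ ys) x = rho ys x"
  unfolding rho_def by (subst dropWhile_append2) auto

text \<open>The run of \<open>x\<close> stops at \<open>u\<close> at the latest.\<close>

lemma rho_append_smaller:
  assumes "x \<in> set \<sigma>" "u < x"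
  shows "rho (\<sigma> @ u # B) x = rho \<sigma> x"
proof -
  obtain xs ys where \<sigma>: "\<sigma> = xs @ x # ys" "x \<notin> set xs"
    using split_list_first[OF assms(1)] by blast
  have "takeWhile (\<lambda>y. x < y) (ys @ u # B) = takeWhile (\<lambda>y. x < y) ys"
    using assms(2) by (induction ys) auto
  then show ?thesis
    using \<sigma> rho_append_right[of x xs "x # ys @ u # B"] rho_append_right[of x xs "x # ys"]
    by (simp add: rho_def)
qed

lemma rho_sorted_desc:
  assumes "sorted_wrt (\<ge>) B"
  shows "rho B x = []"
proof (cases "x \<in> set B")
  case True
  then obtain xs ys where B: "B = xs @ x # ys" "x \<notin> set xs"
    using split_list_first by metis
  then have "\<forall>y\<in>set ys. y \<le> x"
    using assms by (auto simp: sorted_wrt_append)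
  then have "takeWhile (\<lambda>y. x < y) ys = []"
    by (cases ys) auto
  then show ?thesis
    using B rho_append_right[of x xs "x # ys"] by (simp add: rho_def)
next
  case False
  then have "dropWhile (\<lambda>y. y \<noteq> x) B = []" by (auto simp: dropWhile_eq_Nil_conv)
  then show ?thesis unfolding rho_def by (simp only: list.sel takeWhile.simps)
qed

text \<open>The run of \<open>u\<close> is all of \<open>B\<close>, the runs in
  \<open>\<sigma>\<close> are unchanged, and those in the decreasing block are empty.\<close>

lemma Jacobi_append_Cons:
  assumes "\<forall>x\<in>set \<sigma>. u < x" "\<forall>b\<in>set B. u < b" "distinct (\<sigma> @ u # B)" "sorted_wrt (\<ge>) B"
  shows "Jacobi (\<sigma> @ u # B) \<longleftrightarrow> Jacobi \<sigma> \<and> even (length B)"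
proof -
  have "rho (\<sigma> @ u # B) x = rho \<sigma> x" if "x \<in> set \<sigma>" for x
    using rho_append_smaller that assms(1) by blast
  moreover have "rho (\<sigma> @ u # B) u = B"
  proof -
    have "takeWhile (\<lambda>y. u < y) B = B"
      using assms(2) by (simp add: takeWhile_eq_all_conv)
    then show ?thesis
      using assms(3) rho_append_right[of u \<sigma> "u # B"] by (simp add: rho_def)
  qed
  moreover have "rho (\<sigma> @ u # B) b = []" if "b \<in> set B" for b
    using that assms(3) rho_append_right[of b "\<sigma> @ [u]" B] rho_sorted_desc[OF assms(4)] by auto
  ultimately show ?thesis
    unfolding Jacobi_def by (simp add: ball_Un) fastforce
qed

section \<open>Left-to-right minima and ascents\<close>

lemma lrmin_snoc: "lrmin (\<pi> @ [x]) = lrmin \<pi> + (if \<forall>y\<in>set \<pi>. x < y then 1 else 0)"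
proof -
  let ?S = "{j. j < length \<pi> \<and> (\<forall>l<j. \<pi> ! j < \<pi> ! l)}"
  have "{j. j < length (\<pi> @ [x]) \<and> (\<forall>l<j. (\<pi> @ [x]) ! j < (\<pi> @ [x]) ! l)} =
    ?S \<union> (if \<forall>y\<in>set \<pi>. x < y then {length \<pi>} else {})"
    by (auto simp: nth_append less_Suc_eq all_set_conv_all_nth)
  moreover have "finite ?S" by simp
  ultimately show ?thesis unfolding lrmin_def by simp
qed

lemma asc_snoc: "asc (\<pi> @ [x]) = asc \<pi> + (if \<pi> \<noteq> [] \<and> last \<pi> < x then 1 else 0)"
proof -
  let ?S = "{j. Suc j < length \<pi> \<and> \<pi> ! j < \<pi> ! Suc j}"
  have fin: "finite ?S" by (rule finite_subset[of _ "{..<length \<pi>}"]) auto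
  have "{j. Suc j < length (\<pi> @ [x]) \<and> (\<pi> @ [x]) ! j < (\<pi> @ [x]) ! Suc j} =
    ?S \<union> (if \<pi> \<noteq> [] \<and> last \<pi> < x then {length \<pi> - 1} else {})"
    by (cases \<pi> rule: rev_cases) (auto simp: nth_append less_Suc_eq)
  moreover have "length \<pi> - 1 \<notin> ?S" by auto
  ultimately show ?thesis using fin unfolding asc_def by simp
qed

lemma lrmin_append_Cons:
  assumes "\<forall>x\<in>set \<sigma>. u < x" "\<forall>b\<in>set B. u < b"
  shows "lrmin (\<sigma> @ u # B) = Suc (lrmin \<sigma>)"
  using assms(2)
proof (induction B rule: rev_induct)
  case Nil
  then show ?case using assms(1) lrmin_snoc[of \<sigma> u] by auto
next
  case (snoc b B)
  then show ?case using lrmin_snoc[of "\<sigma> @ u # B" b] by auto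
qed

text \<open>The only possible new ascent is from \<open>u\<close> to the first letter of
  \<open>B\<close>: the step into \<open>u\<close> and the steps inside \<open>B\<close> go
  down.\<close>

lemma asc_append_Cons:
  assumes "\<forall>x\<in>set \<sigma>. u < x" "\<forall>b\<in>set B. u < b" "sorted_wrt (\<ge>) B"
  shows "asc (\<sigma> @ u # B) = asc \<sigma> + (if B = [] then 0 else 1)"
  using assms(2,3)
proof (induction B rule: rev_induct)
  case Nil
  then show ?case using assms(1) asc_snoc[of \<sigma> u] by (cases \<sigma> rule: rev_cases) auto
next
  case (snoc b B)
  then show ?case using asc_snoc[of "\<sigma> @ u # B" b]
    by (cases B rule: rev_cases) (auto simp: sorted_wrt_append)
qed

section \<open>Encoding by words\<close>

text \<open>A partially built permutation: \<open>\<sigma>\<close> is the prefix already written and \<open>Q\<close> the queue of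
  letters that are still to be placed as non-minima; they must fit below all non-minima of \<open>\<sigma>\<close>.\<close>

definition admissible :: "nat list \<Rightarrow> nat list \<Rightarrow> bool" where
  "admissible \<sigma> Q \<longleftrightarrow> avoids \<sigma> [1, 2, 3] \<and> Jacobi \<sigma> \<and> sorted_wrt (\<ge>) Q \<and>
    (\<forall>y\<in>tops \<sigma>. \<forall>q\<in>set Q. q \<le> y)"

lemma tops_subset: "tops \<sigma> \<subseteq> set \<sigma>"
  unfolding tops_def by (auto dest: list_emb_set)

lemma admissible_enqueue:
  assumes "\<forall>x\<in>set \<sigma> \<union> set Q. u < x"
  shows "admissible \<sigma> (Q @ [u]) \<longleftrightarrow> admissible \<sigma> Q"
  using assms tops_subset[of \<sigma>] unfolding admissible_def
  by (fastforce simp: sorted_wrt_append intro: less_imp_le)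

text \<open>Leaving the queue turns the letters of \<open>B\<close> into tops; that \<open>Q\<close>
  stays below them is the part of sortedness of \<open>B @ Q\<close> comparing \<open>B\<close> with
  \<open>Q\<close>.\<close>

lemma admissible_dequeue:
  assumes "\<forall>x\<in>set \<sigma> \<union> set B. u < x" "distinct (\<sigma> @ u # B)"
  shows "admissible (\<sigma> @ u # B) Q \<longleftrightarrow> admissible \<sigma> (B @ Q) \<and> even (length B)"
  using assms avoids_123_append_Cons[of \<sigma> u B] Jacobi_append_Cons[of \<sigma> u B]
    tops_append_Cons[of \<sigma> u B]
  unfolding admissible_def by (auto simp: sorted_wrt_append)

text \<open>\<open>m\<close> counts the values read so far, from \<open>n\<close> downwards. For
  \<open>m = n\<close> and empty \<open>Q\<close> the states are the 123-avoiding Jacobi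
  permutations.\<close>

definition is_state :: "nat \<Rightarrow> nat \<Rightarrow> nat list \<Rightarrow> nat list \<Rightarrow> bool" where
  "is_state n m \<sigma> Q \<longleftrightarrow> distinct (\<sigma> @ Q) \<and> set (\<sigma> @ Q) = {n - m<..n} \<and> admissible \<sigma> Q"

text \<open>Words are stored in reverse: the head of the list belongs to the smallest value. The letter
  \<open>0\<close> enqueues the current value; a letter \<open>c > 0\<close> writes it as a new left-to-right minimum,
  followed by the first \<open>c - 1\<close> queued letters.\<close>

fun build :: "nat \<Rightarrow> nat list \<Rightarrow> nat list \<times> nat list" where
  "build n [] = ([], [])"
| "build n (c # w) = (case build n w of (\<sigma>, Q) \<Rightarrow>
     if c = 0 then (\<sigma>, Q @ [n - length w])
     else (\<sigma> @ (n - length w) # take (c - 1) Q, drop (c - 1) Q))"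

text \<open>After reading \<open>w\<close> the queue holds \<open>length w - sum_list w\<close>
  letters; the inequality says that it can supply the \<open>c - 1\<close> letters
  requested.\<close>

fun feasible :: "nat list \<Rightarrow> bool" where
  "feasible [] \<longleftrightarrow> True"
| "feasible (c # w) \<longleftrightarrow> feasible w \<and> c + sum_list w \<le> Suc (length w)"

text \<open>For \<open>c > 0\<close>, oddness makes the block length \<open>c - 1\<close>
  even.\<close>

definition odd_word :: "nat list \<Rightarrow> bool" where
  "odd_word w \<longleftrightarrow> (\<forall>c\<in>set w. c = 0 \<or> odd c)"

lemma greaterThanAtMost_diff_Suc:
  assumes "m < n"
  shows "{n - Suc m<..n} = insert (n - m) {n - m<..n}"
  using assms by auto

text \<open>An equivalence, since one direction runs \<open>build\<close> forwards and the other
  undoes its last step.\<close>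

lemma is_state_enqueue:
  assumes "m < n"
  shows "is_state n (Suc m) \<sigma> (Q @ [n - m]) \<longleftrightarrow> is_state n m \<sigma> Q"
proof
  assume L: "is_state n (Suc m) \<sigma> (Q @ [n - m])"
  then have d: "distinct (\<sigma> @ Q @ [n - m])"
    and s: "insert (n - m) (set \<sigma> \<union> set Q) = insert (n - m) {n - m<..n}"
    and a: "admissible \<sigma> (Q @ [n - m])"
    using greaterThanAtMost_diff_Suc[OF assms] by (auto simp: is_state_def)
  have s': "set \<sigma> \<union> set Q = {n - m<..n}"
    using s d by (subst (asm) insert_ident) auto
  then have "admissible \<sigma> Q"
    using a by (subst (asm) admissible_enqueue) auto
  then show "is_state n m \<sigma> Q" using d s' by (auto simp: is_state_def)
next
  assume R: "is_state n m \<sigma> Q"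
  then have s: "set \<sigma> \<union> set Q = {n - m<..n}" by (simp add: is_state_def)
  then have "\<forall>x\<in>set \<sigma> \<union> set Q. n - m < x" by auto
  then show "is_state n (Suc m) \<sigma> (Q @ [n - m])"
    using R s greaterThanAtMost_diff_Suc[OF assms] admissible_enqueue[of \<sigma> Q "n - m"]
    by (auto simp: is_state_def)
qed

lemma is_state_dequeue:
  assumes "m < n"
  shows "is_state n (Suc m) (\<sigma> @ (n - m) # B) Q \<longleftrightarrow> is_state n m \<sigma> (B @ Q) \<and> even (length B)"
proof
  assume L: "is_state n (Suc m) (\<sigma> @ (n - m) # B) Q"
  then have d: "distinct (\<sigma> @ (n - m) # B @ Q)"
    and s: "insert (n - m) (set \<sigma> \<union> set B \<union> set Q) = insert (n - m) {n - m<..n}"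
    and a: "admissible (\<sigma> @ (n - m) # B) Q"
    using greaterThanAtMost_diff_Suc[OF assms] by (auto simp: is_state_def)
  have s': "set \<sigma> \<union> set B \<union> set Q = {n - m<..n}"
    using s d by (subst (asm) insert_ident) auto
  then have "admissible \<sigma> (B @ Q) \<and> even (length B)"
    using a d by (subst (asm) admissible_dequeue) auto
  then show "is_state n m \<sigma> (B @ Q) \<and> even (length B)"
    using d s' by (auto simp: is_state_def)
next
  assume R: "is_state n m \<sigma> (B @ Q) \<and> even (length B)"
  then have s: "set \<sigma> \<union> (set B \<union> set Q) = {n - m<..n}" by (simp add: is_state_def)
  then have *: "\<forall>x\<in>set \<sigma> \<union> set B. n - m < x" "n - m \<notin> set \<sigma> \<union> set B \<union> set Q" by auto
  then have "distinct (\<sigma> @ (n - m) # B)"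
    using R by (auto simp: is_state_def)
  then show "is_state n (Suc m) (\<sigma> @ (n - m) # B) Q"
    using R s * greaterThanAtMost_diff_Suc[OF assms] admissible_dequeue[of \<sigma> B "n - m" Q]
    by (auto simp: is_state_def)
qed

text \<open>Every letter \<open>c\<close> changes the queue length by \<open>1 - c\<close>. A
  nonzero letter writes a minimum, and its block is nonempty, creating an ascent, iff
  \<open>c > 1\<close>.\<close>

lemma build_correct:
  assumes "feasible w" "odd_word w" "length w \<le> n" "build n w = (\<sigma>, Q)"
  shows "is_state n (length w) \<sigma> Q \<and> length Q + sum_list w = length w \<and>
    lrmin \<sigma> = length (filter (\<lambda>c. c \<noteq> 0) w) \<and> asc \<sigma> = length (filter (\<lambda>c. c > 1) w)"
  using assms
proof (induction w arbitrary: \<sigma> Q)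
  case Nil
  then show ?case
    using avoids_123_iff[of "[]"]
    by (auto simp: is_state_def admissible_def Jacobi_def tops_def lrmin_def asc_def)
next
  case (Cons c w)
  obtain \<sigma>' Q' where b: "build n w = (\<sigma>', Q')" by force
  have ih: "is_state n (length w) \<sigma>' Q'" "length Q' + sum_list w = length w"
    "lrmin \<sigma>' = length (filter (\<lambda>c. c \<noteq> 0) w)" "asc \<sigma>' = length (filter (\<lambda>c. c > 1) w)"
    using Cons.IH[OF _ _ _ b] Cons.prems by (auto simp: odd_word_def)
  have lt: "length w < n" using Cons.prems by simp
  show ?case
  proof (cases "c = 0")
    case True
    then have "\<sigma> = \<sigma>'" "Q = Q' @ [n - length w]"
      using Cons.prems b by auto
    then show ?thesis using ih is_state_enqueue[OF lt] True by auto
  next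
    case False
    define B where "B = take (c - 1) Q'"
    have \<sigma>: "\<sigma> = \<sigma>' @ (n - length w) # B" and Q: "Q' = B @ Q"
      using Cons.prems b False by (auto simp: B_def)
    \<comment> \<open>Feasibility ensures that \<open>take\<close> is not cut short by the end of
      the queue.\<close>
    have c: "c - 1 \<le> length Q'" using Cons.prems(1) ih(2) by auto
    then have lB: "length B = c - 1" by (simp add: B_def)
    have ev: "even (length B)" using False Cons.prems lB by (auto simp: odd_word_def)
    have st: "is_state n (Suc (length w)) \<sigma> Q"
      using is_state_dequeue[OF lt] ih(1) ev \<sigma> Q by auto
    have s: "set \<sigma>' \<union> (set B \<union> set Q) = {n - length w<..n}" "sorted_wrt (\<ge>) B"
      using ih(1) Q by (auto simp: is_state_def admissible_def sorted_wrt_append)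
    then have *: "\<forall>x\<in>set \<sigma>'. n - length w < x" "\<forall>x\<in>set B. n - length w < x" by auto
    show ?thesis
      using st lrmin_append_Cons[OF *] asc_append_Cons[OF * s(2)] ih(2-4) \<sigma> Q lB False
      by (auto simp flip: length_0_conv)
  qed
qed

text \<open>The place of the smallest value \<open>n - m\<close> reveals the last step: in the queue
  it must come last and the letter was \<open>0\<close>; in \<open>\<sigma>\<close> the letters
  after it are the block just dequeued.\<close>

lemma build_surj:
  assumes "is_state n m \<sigma> Q" "m \<le> n"
  shows "\<exists>w. feasible w \<and> odd_word w \<and> length w = m \<and> build n w = (\<sigma>, Q)"
  using assms
proof (induction m arbitrary: \<sigma> Q)
  case 0
  then show ?case by (auto simp: is_state_def odd_word_def intro!: exI[of _ "[]"])
next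
  case (Suc m)
  then have lt: "m < n" by simp
  have s: "set \<sigma> \<union> set Q = insert (n - m) {n - m<..n}" and d: "distinct (\<sigma> @ Q)"
    using Suc.prems greaterThanAtMost_diff_Suc[OF lt] by (auto simp: is_state_def)
  then consider "n - m \<in> set Q" | "n - m \<in> set \<sigma>" by blast
  then show ?case
  proof cases
    case 1
    then obtain Q1 Q2 where Q: "Q = Q1 @ (n - m) # Q2" by (meson split_list)
    have "Q2 = []"
    proof (rule ccontr)
      assume "Q2 \<noteq> []"
      then obtain y where y: "y \<in> set Q2" by (cases Q2) auto
      then have "y \<le> n - m"
        using Suc.prems Q by (auto simp: is_state_def admissible_def sorted_wrt_append)
      moreover have "y \<noteq> n - m" using d Q y by auto
      moreover have "y \<in> insert (n - m) {n - m<..n}" using y Q s by auto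
      ultimately show False by auto
    qed
    then have "is_state n m \<sigma> Q1" using Suc.prems is_state_enqueue[OF lt] Q by simp
    then obtain w where w: "feasible w" "odd_word w" "length w = m" "build n w = (\<sigma>, Q1)"
      using Suc by fastforce
    then have "sum_list w \<le> length w" using build_correct[of w n \<sigma> Q1] lt by simp
    then show ?thesis
      using w Q \<open>Q2 = []\<close> by (intro exI[of _ "0 # w"]) (auto simp: odd_word_def)
  next
    case 2
    then obtain \<sigma>' B where \<sigma>: "\<sigma> = \<sigma>' @ (n - m) # B" by (meson split_list)
    then have st: "is_state n m \<sigma>' (B @ Q)" "even (length B)"
      using Suc.prems is_state_dequeue[OF lt] by auto
    then obtain w where w: "feasible w" "odd_word w" "length w = m" "build n w = (\<sigma>', B @ Q)"
      using Suc by fastforce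
    then have "length (B @ Q) + sum_list w = length w" using build_correct[of w n] lt by simp
    then show ?thesis
      using w \<sigma> st(2) by (intro exI[of _ "Suc (length B) # w"]) (auto simp: odd_word_def)
  qed
qed

text \<open>The smallest value is queued iff the head is \<open>0\<close>; otherwise its only
  occurrence marks where the last block starts, which yields the head and the previous
  state.\<close>

lemma build_inj:
  assumes "feasible w" "odd_word w" "feasible w'" "odd_word w'" "length w = length w'"
    "length w \<le> n" "build n w = build n w'"
  shows "w = w'"
  using assms
proof (induction w arbitrary: w')
  case Nil
  then show ?case by simp
next
  case (Cons c v)
  then obtain c' v' where w': "w' = c' # v'" by (cases w') auto
  obtain \<sigma> Q \<sigma>' Q' where b: "build n v = (\<sigma>, Q)" "build n v' = (\<sigma>', Q')" by force
  have len: "length v' = length v" using Cons.prems w' by simp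
  have pre: "feasible v" "odd_word v" "feasible v'" "odd_word v'" "length v \<le> n"
    using Cons.prems w' by (auto simp: odd_word_def)
  have bc: "is_state n (length v) \<sigma> Q" "length Q + sum_list v = length v"
    "is_state n (length v) \<sigma>' Q'" "length Q' + sum_list v' = length v"
    using build_correct[OF pre(1,2,5) b(1)] build_correct[OF pre(3,4) _ b(2)] pre len by auto
  let ?u = "n - length v"
  have "set (\<sigma> @ Q) = {?u<..n}" "set (\<sigma>' @ Q') = {?u<..n}"
    using bc(1,3) unfolding is_state_def by blast+
  then have u: "?u \<notin> set (\<sigma> @ Q)" "?u \<notin> set (\<sigma>' @ Q')"
    by auto
  have cl: "c - 1 \<le> length Q" "c' - 1 \<le> length Q'"
    using Cons.prems w' bc(2,4) len by auto
  have mem: "?u \<in> set (snd (build n (c # v))) \<longleftrightarrow> c = 0" "?u \<in> set (snd (build n (c' # v'))) \<longleftrightarrow> c' = 0"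
    using b u len by (auto dest: in_set_dropD)
  then have z: "c = 0 \<longleftrightarrow> c' = 0" using Cons.prems(7) w' by simp
  have eq: "\<sigma> = \<sigma>' \<and> Q = Q' \<and> c = c'"
  proof (cases "c = 0")
    case True
    then show ?thesis using z Cons.prems(7) w' b len by auto
  next
    case False
    then have e: "\<sigma> @ ?u # take (c - 1) Q = \<sigma>' @ ?u # take (c' - 1) Q'"
      "drop (c - 1) Q = drop (c' - 1) Q'"
      using z Cons.prems(7) w' b len by auto
    have t: "\<sigma> = \<sigma>'" "take (c - 1) Q = take (c' - 1) Q'"
      using e(1) u by (subst (asm) append_Cons_eq_iff; auto dest: in_set_takeD)+
    then have "c - 1 = c' - 1" using cl by (metis length_take min.absorb2)
    then show ?thesis using t e(2) False z by (metis append_take_drop_id One_nat_def Suc_pred' not_gr0)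
  qed
  then have "build n v = build n v'" using b by simp
  then have "v = v'" using Cons.IH[OF pre(1-4) len[symmetric] pre(5)] by simp
  then show ?case using w' eq by simp
qed

text \<open>The final queue has length \<open>n - sum_list w\<close>, so sum \<open>n\<close> means
  that every value has been written.\<close>

lemma jacobi_count_eq_card_words:
  "jacobi_count [1, 2, 3] n i k = card {w. length w = n \<and> feasible w \<and> odd_word w \<and> sum_list w = n \<and>
    length (filter (\<lambda>c. c \<noteq> 0) w) = i \<and> length (filter (\<lambda>c. c > 1) w) = k}"
    (is "_ = card ?W")
proof -
  let ?P = "{\<pi> \<in> permutations_of_set {1..n}.
    Jacobi \<pi> \<and> avoids \<pi> [1, 2, 3] \<and> lrmin \<pi> = i \<and> asc \<pi> = k}"
  have st: "\<pi> \<in> permutations_of_set {1..n} \<and> Jacobi \<pi> \<and> avoids \<pi> [1, 2, 3] \<longleftrightarrow> is_state n n \<pi> []" for \<pi>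
  proof -
    have "{n - n<..n} = {1..n}" by auto
    then show ?thesis
      by (simp only: is_state_def admissible_def permutations_of_set_def) auto
  qed
  have W: "is_state n n (fst (build n w)) [] \<and> snd (build n w) = [] \<and>
    lrmin (fst (build n w)) = i \<and> asc (fst (build n w)) = k" if "w \<in> ?W" for w
  proof -
    have "length w = n" "feasible w" "odd_word w" "sum_list w = n" using that by auto
    then have "is_state n n (fst (build n w)) (snd (build n w)) \<and> length (snd (build n w)) = 0 \<and>
      lrmin (fst (build n w)) = length (filter (\<lambda>c. c \<noteq> 0) w) \<and>
      asc (fst (build n w)) = length (filter (\<lambda>c. c > 1) w)"
      using build_correct[of w n "fst (build n w)" "snd (build n w)"] by auto
    then show ?thesis using that by auto
  qed
  have inj: "inj_on (\<lambda>w. fst (build n w)) ?W"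
  proof (rule inj_onI)
    fix v w assume vw: "v \<in> ?W" "w \<in> ?W" "fst (build n v) = fst (build n w)"
    have "build n v = build n w"
      using W[OF vw(1)] W[OF vw(2)] vw(3) by (simp add: prod_eq_iff)
    then show "v = w" using vw(1,2) by (intro build_inj[of v w n]) auto
  qed
  have "(\<lambda>w. fst (build n w)) ` ?W = ?P"
  proof (intro equalityI subsetI)
    fix \<pi> assume "\<pi> \<in> (\<lambda>w. fst (build n w)) ` ?W"
    then obtain w where w: "w \<in> ?W" "\<pi> = fst (build n w)" by blast
    then show "\<pi> \<in> ?P" using st[of \<pi>] W[of w] by simp
  next
    fix \<pi> assume P: "\<pi> \<in> ?P"
    then have "is_state n n \<pi> []" using st by blast
    then obtain w where w: "feasible w" "odd_word w" "length w = n" "build n w = (\<pi>, [])"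
      using build_surj[of n n \<pi> "[]"] by auto
    then have "w \<in> ?W" using build_correct[of w n \<pi> "[]"] P by auto
    then show "\<pi> \<in> (\<lambda>w. fst (build n w)) ` ?W" using w(4) by force
  qed
  then show ?thesis
    unfolding jacobi_count_def using card_image[OF inj] by simp
qed

section \<open>Ballot words\<close>

text \<open>The strict form of \<open>feasible\<close>: every nonempty suffix has sum less than its
  length.\<close>

fun ballot :: "nat list \<Rightarrow> bool" where
  "ballot [] \<longleftrightarrow> True"
| "ballot (c # w) \<longleftrightarrow> ballot w \<and> c + sum_list w \<le> length w"

text \<open>The strict inequality for the last letter alone forces \<open>0\<close>, and this
  \<open>0\<close> lengthens all other suffixes by one, turning weak inequalities into strict
  ones.\<close>

lemma ballot_snoc: "ballot (w @ [c]) \<longleftrightarrow> c = 0 \<and> feasible w"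
  by (induction w) auto

text \<open>Removing the head \<open>c\<close> reduces the claim to the sum over \<open>c\<close> of
  \<open>(size M - 1 - sum M + c) / (size M - 1)\<close> times the number of arrangements starting with \<open>c\<close>;
  a fraction \<open>count M c / size M\<close> of all arrangements does so.\<close>

theorem ballot_permutations_of_multiset:
  fixes M :: "nat multiset"
  assumes "sum_mset M \<le> size M"
  shows "real (size M) * real (card {w \<in> permutations_of_multiset M. ballot w}) =
    (real (size M) - real (sum_mset M)) * real (card (permutations_of_multiset M))"
  using assms
proof (induction M rule: multiset_remove_induct)
  case empty
  then show ?case by simp
next
  case (remove M)
  let ?p = "\<lambda>A. real (card (permutations_of_multiset A))"
  let ?b = "\<lambda>A. real (card {w \<in> permutations_of_multiset A. ballot w})"
  let ?N = "real (size M)" and ?s = "real (sum_mset M)"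
  have N0: "size M > 0" using remove.hyps by (simp add: nonempty_has_size)
  have wM: "size M = length w" "sum_mset M = sum_list w" if "w \<in> permutations_of_multiset M" for w
    using that by (auto simp: permutations_of_multiset_def sum_mset_sum_list)
  show ?case
  proof (cases "sum_mset M = size M")
    case True
    \<comment> \<open>The whole word already violates the strict inequality.\<close>
    have "{w \<in> permutations_of_multiset M. ballot w} = {}"
    proof -
      have False if "w \<in> permutations_of_multiset M" "ballot w" for w
        using that wM[of w] True N0 by (cases w) auto
      then show ?thesis by blast
    qed
    then have "?b M = 0" by (simp only: card.empty of_nat_0)
    then show ?thesis using True by simp
  next
    case False
    then have lt: "sum_mset M < size M" using remove.prems by simp
    \<comment> \<open>The inequality for the whole word holds by \<open>lt\<close>, so only the tail
      has to be ballot.\<close>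
    have "{w \<in> permutations_of_multiset M. ballot w} =
      (\<Union>c\<in>set_mset M. (#) c ` {w \<in> permutations_of_multiset (M - {#c#}). ballot w})" (is "?L = ?R")
    proof (intro equalityI subsetI)
      fix w assume w: "w \<in> ?L"
      then obtain c v where "w = c # v" using wM(1)[of w] N0 by (cases w) auto
      then show "w \<in> ?R" using w by (auto simp: permutations_of_multiset_Cons_iff)
    next
      fix w assume "w \<in> ?R"
      then obtain c v where c: "w = c # v" "c \<in># M" "v \<in> permutations_of_multiset (M - {#c#})" "ballot v"
        by blast
      then have "w \<in> permutations_of_multiset M" by (simp add: permutations_of_multiset_Cons_iff)
      then show "w \<in> ?L" using wM[of w] lt c by auto
    qed
    then have "card {w \<in> permutations_of_multiset M. ballot w} =
      (\<Sum>c\<in>set_mset M. card ((#) c ` {w \<in> permutations_of_multiset (M - {#c#}). ballot w}))"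
      by (simp only:) (subst card_UN_disjoint, auto)
    then have bsum: "?b M = (\<Sum>c\<in>set_mset M. ?b (M - {#c#}))"
      by (simp add: card_image)
    \<comment> \<open>Multiplying by \<open>?N\<close> and \<open>?N - 1\<close> avoids division;
      the excess of size over sum in \<open>M - {#c#}\<close> is
      \<open>?N - 1 - ?s + c\<close>.\<close>
    have step: "(?N - 1) * ?b (M - {#c#}) * ?N = (?N - 1 - ?s + real c) * (real (count M c) * ?p M)"
      if c: "c \<in># M" for c
    proof -
      have sz: "real (size (M - {#c#})) = ?N - 1" "size M = Suc (size (M - {#c#}))"
        using c N0 by (auto simp: size_Diff_singleton)
      have sm: "sum_mset M = c + sum_mset (M - {#c#})"
        using c by (rule sum_mset.remove)
      have "sum_mset (M - {#c#}) \<le> size (M - {#c#})" using sm lt sz(2) by linarith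
      then have "(?N - 1) * ?b (M - {#c#}) = (?N - 1 - ?s + real c) * ?p (M - {#c#})"
        using remove.IH[OF c] sz(1) sm by (simp del: of_nat_sum_mset)
      moreover have "?p (M - {#c#}) * ?N = real (count M c) * ?p M"
        using card_permutations_of_multiset_remove_aux[OF c] by (metis mult.commute of_nat_mult)
      ultimately show ?thesis by (metis mult.assoc)
    qed
    have szM: "(\<Sum>c\<in>set_mset M. real (count M c)) = ?N"
      by (simp add: size_multiset_overloaded_eq)
    have sumM: "(\<Sum>c\<in>set_mset M. real c * real (count M c)) = ?s"
    proof -
      obtain xs where xs: "M = mset xs" using ex_mset by metis
      have "sum_mset M = (\<Sum>c\<in>set_mset M. count M c * c)"
        using sum_list_map_eq_sum_count[of "\<lambda>x. x" xs] by (simp add: xs sum_mset_sum_list count_mset)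
      then have "?s = real (\<Sum>c\<in>set_mset M. count M c * c)" by (rule arg_cong)
      then show ?thesis by (simp add: mult.commute del: of_nat_sum_mset)
    qed
    have "(?N - 1) * (?N * ?b M) = (\<Sum>c\<in>set_mset M. (?N - 1) * ?b (M - {#c#}) * ?N)"
      unfolding bsum by (simp add: sum_distrib_left sum_distrib_right algebra_simps)
    also have "\<dots> = (\<Sum>c\<in>set_mset M. (?N - 1 - ?s + real c) * (real (count M c) * ?p M))"
      using step by (intro sum.cong) auto
    also have "\<dots> = ((?N - 1 - ?s) * (\<Sum>c\<in>set_mset M. real (count M c)) +
        (\<Sum>c\<in>set_mset M. real c * real (count M c))) * ?p M"
      unfolding distrib_right sum.distrib sum_distrib_left sum_distrib_right by (simp only: mult.assoc)
    \<comment> \<open>Uses \<open>(N - 1 - s) * N + s = (N - 1) * (N - s)\<close>.\<close>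
    also have "\<dots> = (?N - 1) * ((?N - ?s) * ?p M)"
      unfolding szM sumM by (simp add: algebra_simps)
    finally have eq: "(?N - 1) * (?N * ?b M) = (?N - 1) * ((?N - ?s) * ?p M)" .
    show ?thesis
    \<comment> \<open>The factor \<open>?N - 1\<close> cannot be cancelled for size 1; there
      \<open>M\<close> is \<open>{#0#}\<close>.\<close>
    proof (cases "size M = 1")
      case True
      then obtain c where "M = {#c#}" using size_1_singleton_mset by blast
      then show ?thesis using lt by (simp add: Collect_conv_if)
    next
      case False
      then have "?N - 1 \<noteq> 0" by simp
      with eq show ?thesis by simp
    qed
  qed
qed

text \<open>\<open>A\<close> is a union of full rearrangement classes, and in each of them size
  exceeds sum by exactly 1.\<close>

lemma card_ballot_words:
  assumes "finite A" "\<And>v w. v \<in> A \<Longrightarrow> mset w = mset v \<Longrightarrow> w \<in> A"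
    "\<And>w. w \<in> A \<Longrightarrow> length w = Suc n \<and> sum_list w = n"
  shows "(real n + 1) * real (card {w \<in> A. ballot w}) = real (card A)"
proof -
  have split: "card {w \<in> A. P w} = (\<Sum>M\<in>mset ` A. card {w \<in> permutations_of_multiset M. P w})" for P
  proof -
    have "{w \<in> A. P w} = (\<Union>M\<in>mset ` A. {w \<in> permutations_of_multiset M. P w})"
      using assms(2) by (auto simp: permutations_of_multiset_def)
    then have "card {w \<in> A. P w} = card (\<Union>M\<in>mset ` A. {w \<in> permutations_of_multiset M. P w})"
      by (rule arg_cong)
    also have "\<dots> = (\<Sum>M\<in>mset ` A. card {w \<in> permutations_of_multiset M. P w})"
      using assms(1) by (intro card_UN_disjoint ballI) (auto dest!: permutations_of_multisetD)
    finally show ?thesis .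
  qed
  have "(real n + 1) * real (card {w \<in> permutations_of_multiset M. ballot w}) =
    real (card (permutations_of_multiset M))" if M: "M \<in> mset ` A" for M
  proof -
    obtain w where "w \<in> A" "M = mset w" using M by blast
    then have "size M = Suc n" "sum_mset M = n"
      using assms(3) by (auto simp: sum_mset_sum_list)
    then show ?thesis using ballot_permutations_of_multiset[of M] by (simp add: algebra_simps)
  qed
  then have "(real n + 1) * real (card {w \<in> A. ballot w}) =
    real (\<Sum>M\<in>mset ` A. card (permutations_of_multiset M))"
    unfolding split[of ballot] by (simp add: sum_distrib_left)
  also have "\<dots> = real (card A)" using split[of "\<lambda>_. True"] by simp
  finally show ?thesis .
qed

section \<open>Counting words\<close>

fun compositions :: "nat \<Rightarrow> nat \<Rightarrow> nat" where
  "compositions 0 p = (if p = 0 then 1 else 0)"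
| "compositions (Suc b) p = (\<Sum>t=1..p. compositions b (p - t))"

text \<open>Summing over the first part gives the hockey-stick identity.\<close>

lemma compositions_Suc: "compositions (Suc b) p = (if p = 0 then 0 else (p - 1) choose b)"
proof (induction b arbitrary: p)
  case 0
  show ?case
  proof (cases p)
    case (Suc q)
    have "(\<Sum>t=1..p. if p - t = 0 then 1 else 0 :: nat) = (\<Sum>t=1..p. if t = p then 1 else 0)"
      by (intro sum.cong) auto
    then show ?thesis using Suc by simp
  qed simp
next
  case (Suc b)
  show ?case
  proof (cases p)
    case (Suc q)
    have "compositions (Suc (Suc b)) p = (\<Sum>t=1..p. if p - t = 0 then 0 else (p - t - 1) choose b)"
      by (subst compositions.simps(2)) (simp only: Suc.IH)
    \<comment> \<open>The term \<open>t = p\<close> is zero and drops out.\<close>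
    also have "\<dots> = (\<Sum>t=1..q. (q - t) choose b)"
      using Suc by (simp cong: sum.cong) (intro sum.cong, auto simp: Suc_diff_le)
    also have "\<dots> = (\<Sum>j<q. j choose b)"
      by (intro sum.reindex_bij_witness[of _ "\<lambda>j. q - j" "\<lambda>t. q - t"]) auto
    also have "\<dots> = q choose Suc b"
      by (induction q) auto
    finally show ?thesis using Suc by simp
  qed simp
qed

text \<open>A letter above 1 is \<open>2 * t + 1\<close> with \<open>t \<ge> 1\<close>;
  \<open>p\<close> is the total of these \<open>t\<close>, so it is composed of \<open>b\<close>
  positive parts.\<close>

definition words :: "nat \<Rightarrow> nat \<Rightarrow> nat \<Rightarrow> nat \<Rightarrow> nat list set" where
  "words N a b p = {w. length w = N \<and> odd_word w \<and> length (filter (\<lambda>c. c = 1) w) = a \<and>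
     length (filter (\<lambda>c. c > 1) w) = b \<and> sum_list w = a + b + 2 * p}"

lemma finite_words: "finite (words N a b p)"
proof (rule finite_subset)
  show "words N a b p \<subseteq> {w. set w \<subseteq> {..a + b + 2 * p} \<and> length w = N}"
    using member_le_sum_list unfolding words_def by fastforce
qed (simp add: finite_lists_length_eq)

lemma words_Suc:
  "words (Suc N) a b p = (#) 0 ` words N a b p \<union>
    (case a of 0 \<Rightarrow> {} | Suc a' \<Rightarrow> (#) 1 ` words N a' b p) \<union>
    (case b of 0 \<Rightarrow> {} | Suc b' \<Rightarrow> (\<Union>t\<in>{1..p}. (#) (2 * t + 1) ` words N a b' (p - t)))" (is "_ = ?R")
proof (intro equalityI subsetI)
  fix w assume w: "w \<in> words (Suc N) a b p"
  then obtain c v where cv: "w = c # v" by (cases w) (auto simp: words_def)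
  consider "c = 0" | "c = 1" | t where "t \<ge> 1" "c = 2 * t + 1"
  proof -
    have "c = 0 \<or> odd c" using w cv by (auto simp: words_def odd_word_def)
    then show ?thesis using that by (metis One_nat_def Suc_eq_plus1 less_one linorder_not_le mult_0_right oddE)
  qed
  then show "w \<in> ?R"
  proof cases
    case 1
    then show ?thesis using w cv by (auto simp: words_def odd_word_def)
  next
    case 2
    then show ?thesis using w cv by (cases a) (auto simp: words_def odd_word_def)
  next
    case (3 t)
    then obtain b' where b: "b = Suc b'" using w cv by (cases b) (auto simp: words_def)
    \<comment> \<open>Gives \<open>t \<le> p\<close>, without which \<open>p - t\<close> would
      truncate.\<close>
    have aux: "length (filter (\<lambda>c. c = 1) v) + length (filter (\<lambda>c. c > 1) v) \<le> sum_list v" for v :: "nat list"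
      by (induction v) auto
    have "t \<le> p" using w cv 3 b aux[of v] by (auto simp: words_def)
    moreover from this have "v \<in> words N a b' (p - t)"
      using w cv 3 b by (auto simp: words_def odd_word_def)
    ultimately show ?thesis using cv 3 b by auto
  qed
next
  fix w assume "w \<in> ?R"
  then show "w \<in> words (Suc N) a b p"
    by (auto simp: words_def odd_word_def split: nat.splits)
qed

text \<open>Pascal's rule for trinomial coefficients: the first position holds a letter of neither
  kind, of the \<open>a\<close> kind or of the \<open>b\<close> kind.\<close>

lemma trinomial_Suc:
  "(Suc N choose b) * ((Suc N - b) choose a) = (N choose b) * ((N - b) choose a) +
    (case a of 0 \<Rightarrow> 0 | Suc a' \<Rightarrow> (N choose b) * ((N - b) choose a')) +
    (case b of 0 \<Rightarrow> 0 | Suc b' \<Rightarrow> (N choose b') * ((N - b') choose a))"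
proof (cases "b \<le> N")
  case True
  have "N - b' = Suc (N - b)" if "b = Suc b'" for b'
    using that True by simp
  then show ?thesis
    using True by (cases a; cases b) (auto simp: Suc_diff_le algebra_simps)
next
  case False
  then show ?thesis by (cases a; cases b) auto
qed

lemma card_words: "card (words N a b p) = (N choose b) * ((N - b) choose a) * compositions b p"
proof (induction N arbitrary: a b p)
  case 0
  have "words 0 a b p = (if a = 0 \<and> b = 0 \<and> p = 0 then {[]} else {})"
    by (auto simp: words_def odd_word_def)
  then show ?case by (cases b; cases a) auto
next
  case (Suc N)
  let ?A = "(#) 0 ` words N a b p"
  let ?B = "case a of 0 \<Rightarrow> {} | Suc a' \<Rightarrow> (#) 1 ` words N a' b p"
  let ?C = "case b of 0 \<Rightarrow> {} | Suc b' \<Rightarrow> (\<Union>t\<in>{1..p}. (#) (2 * t + 1) ` words N a b' (p - t))"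
  have fin: "finite ?A" "finite ?B" "finite ?C"
    by (auto simp: finite_words split: nat.splits)
  have B: "card ?B = (case a of 0 \<Rightarrow> 0 | Suc a' \<Rightarrow> card (words N a' b p))"
    by (auto simp: card_image split: nat.splits)
  have C: "card ?C = (case b of 0 \<Rightarrow> 0 | Suc b' \<Rightarrow> (\<Sum>t=1..p. card (words N a b' (p - t))))"
  proof (cases b)
    case (Suc b')
    have "card (\<Union>t\<in>{1..p}. (#) (2 * t + 1) ` words N a b' (p - t)) =
      (\<Sum>t=1..p. card ((#) (2 * t + 1) ` words N a b' (p - t)))"
      by (rule card_UN_disjoint) (auto simp: finite_words)
    then show ?thesis using Suc by (simp add: card_image)
  qed simp
  have "card (words (Suc N) a b p) = card ?A + card ?B + card ?C"
    unfolding words_Suc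
    by (subst card_Un_disjoint card_Un_disjoint; (use fin in \<open>auto split: nat.splits\<close>))+
  also have "\<dots> = ((N choose b) * ((N - b) choose a) +
    (case a of 0 \<Rightarrow> 0 | Suc a' \<Rightarrow> (N choose b) * ((N - b) choose a')) +
    (case b of 0 \<Rightarrow> 0 | Suc b' \<Rightarrow> (N choose b') * ((N - b') choose a))) * compositions b p"
    unfolding B C using Suc.IH
    by (auto simp: card_image sum_distrib_left algebra_simps split: nat.splits)
  finally show ?case unfolding trinomial_Suc[of N b a] .
qed

text \<open>Nonzero letters are odd, which is the source of the parity condition.\<close>

lemma words_stats:
  assumes "odd_word w"
  shows "length (filter (\<lambda>c. c \<noteq> 0) w) = length (filter (\<lambda>c. c = 1) w) + length (filter (\<lambda>c. c > 1) w)"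
    and "even (sum_list w) = even (length (filter (\<lambda>c. c \<noteq> 0) w))"
  using assms by (induction w) (auto simp: odd_word_def)

text \<open>Appending \<open>0\<close> maps these words bijectively onto the ballot words of length
  \<open>n + 1\<close> with \<open>i - k\<close> ones and \<open>k\<close> larger letters, whose sum
  is still \<open>n\<close>.\<close>

lemma card_feasible_words:
  assumes "k \<le> i" "n = i + 2 * p"
  shows "(real n + 1) * real (card {w. length w = n \<and> feasible w \<and> odd_word w \<and> sum_list w = n \<and>
    length (filter (\<lambda>c. c \<noteq> 0) w) = i \<and> length (filter (\<lambda>c. c > 1) w) = k}) =
    real ((Suc n choose k) * ((Suc n - k) choose (i - k)) * compositions k p)"
    (is "_ * real (card ?W) = _")
proof -
  let ?A = "words (Suc n) (i - k) k p"
  have "(\<lambda>w. w @ [0]) ` ?W = {w \<in> ?A. ballot w}"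
  proof (intro equalityI subsetI)
    fix w assume "w \<in> (\<lambda>w. w @ [0]) ` ?W"
    then show "w \<in> {w \<in> ?A. ballot w}"
      using words_stats(1) assms by (auto simp: words_def ballot_snoc odd_word_def)
  next
    fix w assume w: "w \<in> {w \<in> ?A. ballot w}"
    then obtain v c where v: "w = v @ [c]" by (cases w rule: rev_cases) (auto simp: words_def)
    then have "c = 0" using w by (auto simp: ballot_snoc)
    moreover have "odd_word v" using w v by (auto simp: words_def odd_word_def)
    ultimately have "v \<in> ?W"
      using w v words_stats(1)[of v] assms by (auto simp: words_def ballot_snoc)
    then show "w \<in> (\<lambda>w. w @ [0]) ` ?W" using v \<open>c = 0\<close> by blast
  qed
  then have "card ?W = card {w \<in> ?A. ballot w}"
    using card_image[of "\<lambda>w. w @ [0]" ?W] by (simp add: inj_on_def)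
  moreover have "(real n + 1) * real (card {w \<in> ?A. ballot w}) = real (card ?A)"
  proof (rule card_ballot_words)
    fix v w assume v: "v \<in> ?A" and m: "mset w = mset v"
    have "set w = set v" "length w = length v" "sum_list w = sum_list v"
      using m by (metis set_mset_mset, metis size_mset, metis sum_mset_sum_list)
    moreover have "length (filter P w) = length (filter P v)" for P
      using m by (metis mset_filter size_mset)
    ultimately show "w \<in> ?A" using v by (auto simp: words_def odd_word_def)
  qed (rule finite_words, use assms in \<open>auto simp: words_def\<close>)
  ultimately show ?thesis using card_words by simp
qed

section \<open>Translation to the binomial convention and conclusion\<close>

lemma binom_of_nat: "binom (int a) (int b) = real (a choose b)"
  by (simp add: binom_def binomial_gbinomial)

lemma binom_compositions:
  assumes "k \<le> p"
  shows "binom (int p - 1) (int k - 1) = real (compositions k p)"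
proof (cases k)
  \<comment> \<open>Here the convention \<open>binom (-1) (-1) = 1\<close> matches the empty
    composition of \<open>p = 0\<close>.\<close>
  case 0
  then show ?thesis by (auto simp: binom_def)
next
  case (Suc b)
  then have "p > 0" using assms by simp
  then have "int p - 1 = int (p - 1)" "int k - 1 = int b" using Suc by auto
  then show ?thesis using Suc \<open>p > 0\<close> binom_of_nat[of "p - 1" b] compositions_Suc by simp
qed

theorem theorem6p4:
  fixes n i k :: nat
  assumes "n \<ge> i" and "i \<ge> k" and "real k \<le> (real n - real i) / 2"
  shows "real (jacobi_count [1, 2, 3] n i k) =
    (if even n = even i
     then 1 / (real n + 1)
          * binom (int n + 1) (int k)
          * binom (int n + 1 - int k) (int i - int k)
          * binom ((int n - int i) div 2 - 1) (int k - 1)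
     else 0)"
proof (cases "even n = even i")
  case True
  then have "even (n - i)" using assms(1) by simp
  then obtain p where "n - i = 2 * p" by (elim evenE)
  then have p: "n = i + 2 * p" using assms(1) by simp
  \<comment> \<open>This excludes \<open>p = 0\<close> with \<open>k > 0\<close>, where
    \<open>gchoose\<close> at -1 would not vanish.\<close>
  then have kp: "k \<le> p" using assms(3) by simp
  have "int n + 1 = int (Suc n)" "int n + 1 - int k = int (Suc n - k)" "int i - int k = int (i - k)"
    "(int n - int i) div 2 = int p"
    using assms p by auto
  then have b: "binom (int n + 1) (int k) = real (Suc n choose k)"
    "binom (int n + 1 - int k) (int i - int k) = real ((Suc n - k) choose (i - k))"
    "binom ((int n - int i) div 2 - 1) (int k - 1) = real (compositions k p)"
    using binom_of_nat binom_compositions[OF kp] by metis+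
  show ?thesis
    using True card_feasible_words[OF assms(2) p]
    unfolding b jacobi_count_eq_card_words by (simp add: field_simps)
next
  case False
  have "even n = even i" if "odd_word w" "sum_list w = n" "length (filter (\<lambda>c. c \<noteq> 0) w) = i" for w
    using words_stats(2)[OF that(1)] that(2,3) by simp
  then have "{w. length w = n \<and> feasible w \<and> odd_word w \<and> sum_list w = n \<and>
    length (filter (\<lambda>c. c \<noteq> 0) w) = i \<and> length (filter (\<lambda>c. c > 1) w) = k} = {}"
    using False by (intro Collect_empty_eq[THEN iffD2]) metis
  then show ?thesis
    using False unfolding jacobi_count_eq_card_words by (simp only: card.empty of_nat_0 if_False)
qed

end
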